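(* Let $p$ be a prime, $p>3$, and let $t\in D_p$. Then modulo $p$: \begin{align*} \sum_{k=0}^{p-1}C_{2k}\left(\frac{1-t^2}{16}\right)^k&\equiv \frac{1}{2}\left(\frac{2}{p}\right)\left(\left(\frac{1-t}{p}\right)(1-t)+\left(\frac{1+t}{p}\right)(1+t)\right),\\ \sum_{k=0}^{p-1}\binom{4k}{2k}t^{2k}&\equiv\frac{1}{2}\left(\left(\frac{1-4t}{p}\right)(1+2t)+\left(\frac{1+4t}{p}\right)(1-2t)\right). \end{align*}
   Context: $C_n=\frac{1}{n+1}\binom{2n}{n}$ are the Catalan numbers. $D_p$ is the set of rationals whose denominator is not divisible by $p$; congruences between elements of $D_p$ are in the usual sense. For $c=a/b\in D_p$ in lowest terms, $\left(\frac{c}{p}\right)=\left(\frac{ab}{p}\right)$ (Legendre symbol), which is $0$ if $p\mid a$. *)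

theory Defs
  imports "HOL-Number_Theory.Number_Theory"
begin

definition catalan :: "nat \<Rightarrow> rat" where
  "catalan n = 1 / of_nat (n + 1) * of_nat ((2 * n) choose n)"

(* quotient_of yields (numerator, denominator) in lowest terms with positive denominator. *)
definition D :: "nat \<Rightarrow> rat set" where
  "D p = {x. \<not> int p dvd snd (quotient_of x)}"

(* Congruence in the ring D p modulo its ideal p * D p. *)
definition cong_D :: "nat \<Rightarrow> rat \<Rightarrow> rat \<Rightarrow> bool" where
  "cong_D p x y \<longleftrightarrow> x \<in> D p \<and> y \<in> D p \<and> (\<exists>z \<in> D p. x - y = of_nat p * z)"

definition Legendre_rat :: "rat \<Rightarrow> nat \<Rightarrow> int" where
  "Legendre_rat c p = Legendre (fst (quotient_of c) * snd (quotient_of c)) (int p)"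

end

theory Submission
  imports Defs
begin

text \<open>
  Let \<open>p = 2 m + 1\<close> and \<open>B\<^sub>n = (2n choose n)\<close>. Modulo \<open>p\<close> one has \<open>B\<^sub>n \<equiv> (m choose n) (-4)\<^sup>n\<close> and
  \<open>B\<^bsub>p+n\<^esub> \<equiv> 2 B\<^sub>n\<close> for \<open>n < p\<close>, hence \<open>\<Sum>n<2p. B\<^sub>n y\<^sup>n \<equiv> (1 - 4y)\<^sup>m (1 + 2y\<^sup>p)\<close>. The second congruence
  is the even part of this at \<open>y = t\<close>, by Fermat and Euler's criterion.

  For the first one, \<open>C\<^sub>n = 2 B\<^sub>n - B\<^bsub>n+1\<^esub> / 2\<close> reduces the sum to the even and odd parts of
  \<open>(1 + u)\<^bsup>m+1\<^esup>\<close> with \<open>u\<^sup>2 = 1 - t\<^sup>2\<close>. Put \<open>\<alpha> = (1 + t) / 2 = a\<^sup>2\<close> and \<open>\<beta> = (1 - t) / 2 = b\<^sup>2\<close>; then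
  \<open>1 + u = (a + b)\<^sup>2\<close>, and \<open>(a + b)\<^bsup>p+1\<^esup> \<equiv> (a\<^sup>p + b\<^sup>p) (a + b)\<close> gives the value \<open>\<alpha>\<^bsup>m+1\<^esup> + \<beta>\<^bsup>m+1\<^esup>\<close>.
\<close>

subsection \<open>Even and odd parts of the binomial expansion\<close>

text \<open>With \<open>binom_odd\<close>, the coefficients of 1 and u in (1 + u)^n when u^2 =
  \<open>w\<close>; they make sense whether or not \<open>w\<close> is a square. The bound
  \<open>n\<close> is generous: the surplus binomials vanish.\<close>

definition binom_even :: "nat \<Rightarrow> 'a \<Rightarrow> 'a :: comm_ring_1" where
  "binom_even n w = (\<Sum>j\<le>n. of_nat (n choose (2 * j)) * w ^ j)"

definition binom_odd :: "nat \<Rightarrow> 'a \<Rightarrow> 'a :: comm_ring_1" where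
  "binom_odd n w = (\<Sum>j\<le>n. of_nat (n choose (2 * j + 1)) * w ^ j)"

lemma binom_even_0 [simp]: "binom_even 0 w = 1"
  by (simp add: binom_even_def)

lemma binom_odd_0 [simp]: "binom_odd 0 w = 0"
  by (simp add: binom_odd_def)

text \<open>This is the part free of u in (1 + u)(e + u o) with u^2 = \<open>w\<close>; on
  coefficients it is Pascal's rule after splitting off j = 0.\<close>

lemma binom_even_Suc: "binom_even (Suc n) w = binom_even n w + w * binom_odd n w"
proof -
  have "binom_even n w = (\<Sum>j\<le>Suc n. of_nat (n choose (2 * j)) * w ^ j)"
    by (simp add: binom_even_def binomial_eq_0)
  also have "\<dots> = 1 + (\<Sum>j\<le>n. of_nat (n choose (2 * j + 2)) * w ^ Suc j)"
    by (subst sum.atMost_Suc_shift) simp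
  finally have "binom_even n w = 1 + (\<Sum>j\<le>n. of_nat (n choose (2 * j + 2)) * w ^ Suc j)" .
  moreover have "binom_even (Suc n) w = 1 + (\<Sum>j\<le>n. of_nat (Suc n choose (2 * j + 2)) * w ^ Suc j)"
    unfolding binom_even_def by (subst sum.atMost_Suc_shift) simp
  ultimately show ?thesis
    by (simp add: binom_odd_def sum_distrib_left sum.distrib algebra_simps)
qed

lemma binom_odd_Suc: "binom_odd (Suc n) w = binom_even n w + binom_odd n w"
  by (simp add: binom_even_def binom_odd_def sum.distrib distrib_left distrib_right binomial_eq_0)

lemma one_plus_power_binom: "(1 + u) ^ n = binom_even n (u\<^sup>2) + u * binom_odd n (u\<^sup>2)"
  by (induction n) (simp_all add: binom_even_Suc binom_odd_Suc algebra_simps power2_eq_square)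

text \<open>With \<open>\<alpha> = a\<^sup>2\<close> and \<open>\<beta> = b\<^sup>2\<close> these two identities say that
  \<open>(1 + 2ab)\<^sup>n = (a + b)\<^bsup>2n\<^esup>\<close>, without adjoining square roots.\<close>

lemma binom_even_odd_double:
  fixes \<alpha> \<beta> :: "'a :: field"
  assumes "\<alpha> + \<beta> = 1" "\<beta> \<noteq> 0"
  shows "binom_even n (4 * \<alpha> * \<beta>) = \<beta> ^ n * binom_even (2 * n) (\<alpha> / \<beta>) \<and>
    2 * \<beta> * binom_odd n (4 * \<alpha> * \<beta>) = \<beta> ^ n * binom_odd (2 * n) (\<alpha> / \<beta>)"
proof (induction n)
  case (Suc n)
  define w e o' where "w = \<alpha> / \<beta>" and "e = \<beta> ^ n * binom_even (2 * n) w"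
    and "o' = \<beta> ^ n * binom_odd (2 * n) w"
  have \<alpha>: "\<alpha> = \<beta> * w" and one: "\<beta> * (1 + w) = 1"
    using assms by (simp_all add: w_def field_simps)
  have IH: "binom_even n (4 * \<alpha> * \<beta>) = e" "2 * \<beta> * binom_odd n (4 * \<alpha> * \<beta>) = o'"
    using Suc by (simp_all add: w_def e_def o'_def)
  \<comment> \<open>Two steps of the recurrences multiply by (1 + u)^2 = (1 + w) + 2u, where u^2 =
    w; by \<open>one\<close> the first coefficient, times \<beta>, becomes 1.\<close>
  have "\<beta> ^ Suc n * binom_even (2 * Suc n) w = \<beta> * (1 + w) * e + 2 * (\<beta> * w) * o'"
    by (simp add: binom_even_Suc binom_odd_Suc e_def o'_def algebra_simps)
  also have "\<dots> = e + 4 * \<alpha> * \<beta> * binom_odd n (4 * \<alpha> * \<beta>)"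
    unfolding one \<alpha>[symmetric] IH(2)[symmetric] by (simp add: algebra_simps)
  finally have 1: "\<beta> ^ Suc n * binom_even (2 * Suc n) w = binom_even (Suc n) (4 * \<alpha> * \<beta>)"
    by (simp add: binom_even_Suc IH(1))
  have "\<beta> ^ Suc n * binom_odd (2 * Suc n) w = 2 * \<beta> * e + \<beta> * (1 + w) * o'"
    by (simp add: binom_even_Suc binom_odd_Suc e_def o'_def algebra_simps)
  also have "\<dots> = 2 * \<beta> * (e + binom_odd n (4 * \<alpha> * \<beta>))"
    unfolding one IH(2)[symmetric] by (simp add: algebra_simps)
  finally have 2: "\<beta> ^ Suc n * binom_odd (2 * Suc n) w = 2 * \<beta> * binom_odd (Suc n) (4 * \<alpha> * \<beta>)"
    by (simp add: binom_odd_Suc IH(1))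
  show ?case using 1[symmetric] 2[symmetric] unfolding w_def by blast
qed simp

subsection \<open>Central binomial coefficients\<close>

abbreviation central_binomial :: "nat \<Rightarrow> nat" where
  "central_binomial n \<equiv> (2 * n) choose n"

text \<open>Symmetry and Pascal give the factor 2, absorption the rest. The division-free form
  serves both the integer congruences and the rational Catalan numbers.\<close>

lemma central_binomial_Suc:
  "of_nat (Suc n) * of_nat (central_binomial (Suc n)) =
    (2 * (2 * of_nat n + 1) * of_nat (central_binomial n) :: 'a :: comm_semiring_1)"
proof -
  have "Suc (2 * n) choose n = Suc (2 * n) choose Suc n"
    using binomial_symmetric[of n "Suc (2 * n)"] by simp
  then have 1: "central_binomial (Suc n) = 2 * (Suc (2 * n) choose Suc n)" by simp
  have 2: "Suc n * (Suc (2 * n) choose Suc n) = Suc (2 * n) * central_binomial n"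
    by (rule Suc_times_binomial)
  have "Suc n * central_binomial (Suc n) = 2 * (2 * n + 1) * central_binomial n"
    unfolding 1 mult.left_commute[of "Suc n" 2] 2 by simp
  from arg_cong[OF this, of "of_nat :: nat \<Rightarrow> 'a"] show ?thesis
    by (simp only: of_nat_mult of_nat_add of_nat_numeral of_nat_1)
qed

text \<open>The recurrence says that the next central binomial is (4 - 2/(n+1)) times the present
  one. This form also shows Catalan numbers to be p-integral for odd p, even when p divides n +
  1.\<close>

lemma catalan_central_binomial:
  "catalan n = 2 * of_nat (central_binomial n) - of_nat (central_binomial (Suc n)) / 2"
proof -
  have "(of_nat (Suc n) :: rat) \<noteq> 0" by (rule of_nat_neq_0)
  then have "of_nat (central_binomial (Suc n)) =
      (2 * (2 * of_nat n + 1) * of_nat (central_binomial n) / of_nat (Suc n) :: rat)"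
    using central_binomial_Suc[of n, where ?'a = rat]
    by (simp only: eq_divide_eq mult.commute simp_thms if_False if_True)
  then show ?thesis
    by (simp add: catalan_def field_simps del: binomial_Suc_Suc mult_Suc_right)
qed

lemma sum_lessThan_plus:
  fixes f :: "nat \<Rightarrow> 'a :: comm_monoid_add"
  shows "sum f {..<a + b} = sum f {..<a} + (\<Sum>j<b. f (a + j))"
  by (induction b) (simp_all add: add.assoc)

subsection \<open>Congruences between \<open>p\<close>-integral rationals\<close>

text \<open>The reduced denominator divides every other denominator, so any fraction whose
  denominator is prime to p is a witness. Closure properties then need no lowest terms.\<close>

lemma D_iff: "x \<in> D p \<longleftrightarrow> (\<exists>a b. \<not> int p dvd b \<and> x = of_int a / of_int b)"
proof
  assume "x \<in> D p"
  then show "\<exists>a b. \<not> int p dvd b \<and> x = of_int a / of_int b"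
    using quotient_of_div[of x "fst (quotient_of x)" "snd (quotient_of x)"]
    by (auto simp: D_def)
next
  assume "\<exists>a b. \<not> int p dvd b \<and> x = of_int a / of_int b"
  then obtain a b where b: "\<not> int p dvd b" and x: "x = of_int a / of_int b" by blast
  obtain n d where nd: "quotient_of x = (n, d)" by force
  have "coprime n d" "d > 0" "x = of_int n / of_int d"
    using quotient_of_coprime[OF nd] quotient_of_denom_pos[OF nd] quotient_of_div[OF nd] by auto
  moreover have "b \<noteq> 0" using b by auto
  ultimately have "of_int (n * b) = (of_int (a * d) :: rat)"
    using x by (simp add: field_simps)
  then have "n * b = a * d" by linarith
  then have "d dvd b"
    using \<open>coprime n d\<close> by (metis coprime_commute coprime_dvd_mult_right_iff dvd_triv_right)
  then show "x \<in> D p" using b nd by (auto simp: D_def dest: dvd_trans)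
qed

context
  fixes p :: nat
  assumes prime_p: "prime p"
begin

lemma D_of_int [simp]: "of_int a \<in> D p"
  unfolding D_iff using prime_p
  by (intro exI[of _ a] exI[of _ 1]) auto

lemma D_of_nat [simp]: "of_nat n \<in> D p"
  using D_of_int[of "int n"] by simp

lemma D_numeral [simp]: "numeral n \<in> D p" "1 \<in> D p" "0 \<in> D p"
  using D_of_int[of "numeral n"] D_of_int[of 1] D_of_int[of 0] by simp_all

lemma D_mult [simp]:
  assumes "x \<in> D p" "y \<in> D p" shows "x * y \<in> D p"
proof -
  obtain a b c d where "\<not> int p dvd b" "x = of_int a / of_int b"
    "\<not> int p dvd d" "y = of_int c / of_int d"
    using assms unfolding D_iff by blast
  then show ?thesis unfolding D_iff using prime_p
    by (intro exI[of _ "a * c"] exI[of _ "b * d"]) (auto simp: prime_dvd_mult_iff)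
qed

lemma D_add [simp]:
  assumes "x \<in> D p" "y \<in> D p" shows "x + y \<in> D p"
proof -
  obtain a b c d where *: "\<not> int p dvd b" "x = of_int a / of_int b"
    "\<not> int p dvd d" "y = of_int c / of_int d"
    using assms unfolding D_iff by blast
  then have "b \<noteq> 0" "d \<noteq> 0" by auto
  with * show ?thesis unfolding D_iff using prime_p
    by (intro exI[of _ "a * d + c * b"] exI[of _ "b * d"])
      (auto simp: prime_dvd_mult_iff field_simps)
qed

lemma D_uminus [simp]: "x \<in> D p \<Longrightarrow> - x \<in> D p"
  using D_mult[OF D_of_int[of "-1"]] by simp

lemma D_diff [simp]: "x \<in> D p \<Longrightarrow> y \<in> D p \<Longrightarrow> x - y \<in> D p"
  using D_add[of x "- y"] by simp

lemma D_power [simp]: "x \<in> D p \<Longrightarrow> x ^ n \<in> D p"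
  by (induction n) auto

lemma D_sum [simp]: "(\<And>i. i \<in> A \<Longrightarrow> f i \<in> D p) \<Longrightarrow> sum f A \<in> D p"
  by (induction A rule: infinite_finite_induct) auto

lemma cong_D_refl [simp]: "x \<in> D p \<Longrightarrow> cong_D p x x"
  unfolding cong_D_def by (auto intro: bexI[of _ 0])

lemma cong_D_sym: "cong_D p x y \<Longrightarrow> cong_D p y x"
  unfolding cong_D_def by (metis D_uminus minus_diff_eq mult_minus_right)

lemma cong_D_trans [trans]:
  assumes "cong_D p x y" "cong_D p y z" shows "cong_D p x z"
proof -
  obtain u v where "u \<in> D p" "v \<in> D p" "x - y = of_nat p * u" "y - z = of_nat p * v"
    using assms unfolding cong_D_def by blast
  then show ?thesis using assms unfolding cong_D_def
    by (intro conjI bexI[of _ "u + v"]) (auto simp: algebra_simps)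
qed

lemma cong_D_add:
  assumes "cong_D p x y" "cong_D p x' y'" shows "cong_D p (x + x') (y + y')"
proof -
  obtain u v where "u \<in> D p" "v \<in> D p" "x - y = of_nat p * u" "x' - y' = of_nat p * v"
    using assms unfolding cong_D_def by blast
  then show ?thesis using assms unfolding cong_D_def
    by (intro conjI bexI[of _ "u + v"]) (auto simp: algebra_simps)
qed

lemma cong_D_mult:
  assumes "cong_D p x y" "cong_D p x' y'" shows "cong_D p (x * x') (y * y')"
proof -
  obtain u v where *: "u \<in> D p" "v \<in> D p" "x - y = of_nat p * u" "x' - y' = of_nat p * v"
    using assms unfolding cong_D_def by blast
  have "x * x' - y * y' = (x - y) * x' + y * (x' - y')" by (simp add: algebra_simps)
  also have "\<dots> = of_nat p * (u * x' + y * v)" unfolding * by (simp add: algebra_simps)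
  finally show ?thesis using assms * unfolding cong_D_def by auto
qed

lemma cong_D_uminus: "cong_D p x y \<Longrightarrow> cong_D p (- x) (- y)"
  using cong_D_mult[of "-1" "-1" x y] by simp

lemma cong_D_diff:
  "cong_D p x y \<Longrightarrow> cong_D p x' y' \<Longrightarrow> cong_D p (x - x') (y - y')"
  using cong_D_add[of x y "- x'" "- y'"] cong_D_uminus by simp

lemma cong_D_power: "cong_D p x y \<Longrightarrow> cong_D p (x ^ n) (y ^ n)"
  by (induction n) (auto intro: cong_D_mult)

lemma cong_D_sum:
  "(\<And>i. i \<in> A \<Longrightarrow> cong_D p (f i) (g i)) \<Longrightarrow> cong_D p (sum f A) (sum g A)"
  by (induction A rule: infinite_finite_induct) (auto intro: cong_D_add)

lemma cong_D_of_int: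
  assumes "[a = b] (mod int p)" shows "cong_D p (of_int a) (of_int b)"
proof -
  obtain k where "a - b = int p * k"
    using assms by (auto simp: cong_iff_dvd_diff)
  then have "of_int a - of_int b = (of_nat p * of_int k :: rat)"
    by (metis of_int_diff of_int_mult of_int_of_nat_eq)
  then show ?thesis unfolding cong_D_def by auto
qed

text \<open>\<open>D p\<close> is a local ring with maximal ideal generated by p: an element is
  divisible by p or a unit, according to its numerator.\<close>

lemma D_inverse_cases:
  assumes "x \<in> D p"
  obtains "cong_D p x 0" | "x \<noteq> 0" "1 / x \<in> D p"
proof -
  obtain a b where ab: "\<not> int p dvd b" "x = of_int a / of_int b"
    using assms unfolding D_iff by blast
  show ?thesis
  proof (cases "int p dvd a")
    case True
    have "1 / of_int b \<in> D p" unfolding D_iff using ab(1) by (metis of_int_1)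
    moreover have "cong_D p (of_int a) (of_int 0)"
      using True by (intro cong_D_of_int) (simp add: cong_0_iff)
    ultimately have "cong_D p (of_int a * (1 / of_int b)) (of_int 0 * (1 / of_int b))"
      by (intro cong_D_mult) auto
    then show ?thesis using that ab by simp
  next
    case False
    then have "1 / x \<in> D p" unfolding D_iff using ab(2)
      by (intro exI[of _ b] exI[of _ a]) simp
    moreover have "x \<noteq> 0" using ab False by auto
    ultimately show ?thesis using that by blast
  qed
qed

lemma cong_D_fermat:
  assumes "x \<in> D p" shows "cong_D p (x ^ p) x"
proof -
  obtain a b where ab: "\<not> int p dvd b" "x = of_int a / of_int b"
    using assms unfolding D_iff by blast
  have fermat: "[c ^ p = c] (mod int p)" for c :: int
  proof (cases "int p dvd c")
    case True
    then show ?thesis using prime_p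
      by (metis cong_0_iff cong_sym cong_trans dvd_power dvd_trans prime_gt_0_nat)
  next
    case False
    then have "coprime c (int p)" using prime_p
      by (metis coprime_commute prime_imp_coprime prime_nat_int_transfer)
    moreover have "residues (int p)"
      using prime_p prime_gt_1_nat by (simp add: residues_def)
    ultimately have "[c ^ (p - 1) = 1] (mod int p)"
      using residues.euler_theorem[of "int p" c] totient_prime[OF prime_p] by simp
    then have "[c ^ (p - 1) * c = 1 * c] (mod int p)" by (rule cong_mult) simp
    then show ?thesis using prime_p by (simp flip: power_Suc2 add: prime_gt_0_nat)
  qed
  have b0: "b \<noteq> 0" using ab by auto
  have inv: "1 / of_int b \<in> D p" unfolding D_iff using ab(1) by (metis of_int_1)
  \<comment> \<open>Both a^p b and a b^p are congruent to ab; dividing by b^(p+1) leaves (a/b)^p and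
    a/b.\<close>
  have "cong_D p (of_int (a ^ p) * of_int b * (1 / of_int b) ^ Suc p) (of_int a * of_int (b ^ p) * (1 / of_int b) ^ Suc p)"
    by (intro cong_D_mult cong_D_of_int fermat cong_sym[OF fermat] cong_D_refl D_power inv)
  then show ?thesis using b0 by (simp add: ab(2) power_divide field_simps)
qed


lemma D_half:
  assumes "odd p" shows "1 / 2 \<in> D p"
proof -
  have "\<not> p dvd 2" using assms prime_p
    by (metis primes_dvd_imp_eq two_is_prime_nat dvd_refl)
  then have "\<not> int p dvd 2" by (metis int_dvd_int_iff of_nat_numeral)
  then show ?thesis unfolding D_iff by (intro exI[of _ 1] exI[of _ 2]) simp
qed

section \<open>Central binomial coefficients modulo an odd prime\<close>

context
  fixes m :: nat
  assumes p: "p = 2 * m + 1"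
begin

text \<open>The central binomial is (-4)^n times the binomial of -1/2 over n, and m is congruent to
  -1/2. Concretely, both sides obey the same recurrence modulo p, whose factor n + 1 < p can be
  cancelled.\<close>

lemma central_binomial_cong:
  assumes "n < p"
  shows "[int (central_binomial n) = int (m choose n) * (- 4) ^ n] (mod int p)"
  using assms
proof (induction n)
  case (Suc n)
  have "int (Suc n) * int (central_binomial (Suc n)) = 2 * (2 * int n + 1) * int (central_binomial n)"
    by (rule central_binomial_Suc)
  also have "[\<dots> = 2 * (2 * int n + 1) * (int (m choose n) * (- 4) ^ n)] (mod int p)"
    using Suc by (intro cong_mult) auto
  also have "[2 * (2 * int n + 1) * (int (m choose n) * (- 4) ^ n) =
      (2 * (2 * int n + 1) + int p * (- 2)) * (int (m choose n) * (- 4) ^ n)] (mod int p)"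
    \<comment> \<open>Subtracting 2p = 4m + 2 is chosen to turn 4n + 2 into -4(m - n).\<close>
    by (intro cong_mult) (auto simp: cong_iff_dvd_diff)
  also have "(2 * (2 * int n + 1) + int p * (- 2)) = (- 4) * (int m - int n)"
    by (simp add: p)
  also have "(- 4) * (int m - int n) * (int (m choose n) * (- 4) ^ n) =
      ((int m - int n) * int (m choose n)) * (- 4) ^ Suc n" by (simp add: algebra_simps)
  also have "(int m - int n) * int (m choose n) = int (Suc n) * int (m choose Suc n)"
  proof (cases "n \<le> m")
    case True
    have "(m - n) * (m choose n) = Suc n * (m choose Suc n)"
      by (simp only: binomial_absorb_comp binomial_absorption)
    then show ?thesis using True by (metis of_nat_diff of_nat_mult)
  qed (simp add: binomial_eq_0)
  finally have "[int (Suc n) * int (central_binomial (Suc n)) =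
    int (Suc n) * (int (m choose Suc n) * (- 4) ^ Suc n)] (mod int p)"
    by (simp only: mult.assoc)
  moreover have "coprime (int (Suc n)) (int p)"
    using Suc.prems prime_p by (metis coprime_commute coprime_int_iff nat_dvd_not_less
      prime_imp_coprime zero_less_Suc)
  ultimately show ?case by (simp only: cong_mult_lcancel)
qed simp

text \<open>In the sum of the squares of \<open>p choose k\<close>, only k = 0 and k = p survive
  modulo p.\<close>

lemma central_binomial_prime_cong: "[int (central_binomial p) = 2] (mod int p)"
proof -
  have "int p dvd (\<Sum>k\<in>{0<..<p}. int ((p choose k)\<^sup>2))"
    using prime_p by (intro dvd_sum)
     (simp add: dvd_choose_prime power2_eq_square)
  moreover have "{..p} = insert 0 (insert p {0<..<p})" using prime_p prime_gt_0_nat by auto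
  then have "central_binomial p = 2 + (\<Sum>k\<in>{0<..<p}. (p choose k)\<^sup>2)"
    using prime_gt_0_nat[OF prime_p] choose_square_sum[of p] by simp
  ultimately show ?thesis by (simp add: cong_iff_dvd_diff)
qed

text \<open>The recurrence has the same coefficients at p + r as at r modulo p, so the factor 2 at r
  = 0 persists.\<close>

lemma central_binomial_shift_cong:
  assumes "r < p"
  shows "[int (central_binomial (p + r)) = 2 * int (central_binomial r)] (mod int p)"
  using assms
proof (induction r)
  case 0
  then show ?case using central_binomial_prime_cong by simp
next
  case (Suc r)
  have "[int (Suc r) * int (central_binomial (p + Suc r)) =
     int (Suc (p + r)) * int (central_binomial (p + Suc r))] (mod int p)"
    by (intro cong_mult) (auto simp: cong_iff_dvd_diff)
  also have "int (Suc (p + r)) * int (central_binomial (p + Suc r)) =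
     2 * (2 * int (p + r) + 1) * int (central_binomial (p + r))"
    unfolding add_Suc_right by (rule central_binomial_Suc)
  also have "[\<dots> = 2 * (2 * int r + 1) * (2 * int (central_binomial r))] (mod int p)"
    using Suc by (intro cong_mult) (auto simp: cong_iff_dvd_diff)
  also have "2 * (2 * int r + 1) * (2 * int (central_binomial r)) =
    int (Suc r) * (2 * int (central_binomial (Suc r)))"
    using central_binomial_Suc[of r, where ?'a = int] by (simp only: mult.left_commute)
  finally have "[int (Suc r) * int (central_binomial (p + Suc r)) =
    int (Suc r) * (2 * int (central_binomial (Suc r)))] (mod int p)" .
  moreover have "coprime (int (Suc r)) (int p)"
    using Suc.prems prime_p by (metis coprime_commute coprime_int_iff nat_dvd_not_less
      prime_imp_coprime zero_less_Suc)
  ultimately show ?case by (simp only: cong_mult_lcancel)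
qed

lemma central_binomial_cong_D:
  assumes "n < p"
  shows "cong_D p (of_nat (central_binomial n)) (of_nat (m choose n) * (- 4) ^ n)"
  using cong_D_of_int[OF central_binomial_cong[OF assms]] by simp

lemma central_binomial_shift_cong_D:
  assumes "r < p"
  shows "cong_D p (of_nat (central_binomial (p + r))) (2 * of_nat (central_binomial r))"
  using cong_D_of_int[OF central_binomial_shift_cong[OF assms]] by simp

section \<open>Truncated sums of central binomial coefficients\<close>

lemma D_binom [simp]:
  assumes "w \<in> D p"
  shows "binom_even n w \<in> D p" "binom_odd n w \<in> D p"
  using assms by (auto simp: binom_even_def binom_odd_def)

lemma sum_central_binomial_even_half:
  assumes "x \<in> D p"
  shows "cong_D p (\<Sum>j<Suc m. of_nat (central_binomial (2 * j)) * x ^ j) (binom_even m (16 * x))"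
proof -
  have "binom_even m (16 * x) = (\<Sum>j<Suc m. of_nat (m choose (2 * j)) * (- 4) ^ (2 * j) * x ^ j)"
    by (simp only: binom_even_def lessThan_Suc_atMost power_mult)
      (simp add: power_mult_distrib mult.assoc)
  moreover have lt: "2 * j < p" if "j < Suc m" for j using that p by simp
  ultimately show ?thesis using assms
    by (simp only:) (intro cong_D_sum cong_D_mult central_binomial_cong_D, auto simp: lt)
qed

text \<open>Here (-4)^(2j+1) = -4 * 16^j. The range stops before j = m, where the index would reach
  p; the corresponding terms of \<open>binom_odd m\<close> vanish.\<close>

lemma sum_central_binomial_odd_half:
  assumes "x \<in> D p"
  shows "cong_D p (\<Sum>j<m. of_nat (central_binomial (2 * j + 1)) * x ^ j) (- 4 * binom_odd m (16 * x))"
proof -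
  have "- 4 * binom_odd m (16 * x) = - 4 * (\<Sum>j<m. of_nat (m choose (2 * j + 1)) * (16 * x) ^ j)"
    unfolding binom_odd_def lessThan_Suc_atMost[symmetric] by (simp add: binomial_eq_0)
  also have "\<dots> = (\<Sum>j<m. of_nat (m choose (2 * j + 1)) * (- 4) ^ (2 * j + 1) * x ^ j)"
    by (simp only: power_add power_mult sum_distrib_left)
      (simp add: power_mult_distrib mult_ac sum_negf)
  finally have eq: "- 4 * binom_odd m (16 * x) = \<dots>" .
  have "2 * j + 1 < p" if "j < m" for j using that p by simp
  then show ?thesis unfolding eq using assms
    by (intro cong_D_sum cong_D_mult central_binomial_cong_D) auto
qed

text \<open>The sum is cut where 2k passes p: k = m + 1 + j gives 2k = p + (2j + 1), so the upper
  half is twice an odd-index sum below p, and 2 * (-4) gives the -8.\<close>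

lemma sum_central_binomial_even:
  assumes "x \<in> D p"
  shows "cong_D p (\<Sum>k<p. of_nat (central_binomial (2 * k)) * x ^ k)
    (binom_even m (16 * x) - 8 * x ^ Suc m * binom_odd m (16 * x))"
proof -
  let ?f = "\<lambda>k. of_nat (central_binomial (2 * k)) * x ^ k"
    and ?S = "\<Sum>j<m. of_nat (central_binomial (2 * j + 1)) * x ^ j"
  have lt: "2 * j + 1 < p" if "j < m" for j using that p by simp
  have "cong_D p (?f (Suc m + j)) (2 * x ^ Suc m * (of_nat (central_binomial (2 * j + 1)) * x ^ j))"
    if "j < m" for j
  proof -
    have "2 * (Suc m + j) = p + (2 * j + 1)" using p by simp
    then have "cong_D p (?f (Suc m + j)) (2 * of_nat (central_binomial (2 * j + 1)) * x ^ (Suc m + j))"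
      using assms lt[OF that]
      by (simp only:) (intro cong_D_mult central_binomial_shift_cong_D cong_D_refl D_power)
    then show ?thesis by (simp only: power_add mult_ac)
  qed
  then have "cong_D p (\<Sum>j<m. ?f (Suc m + j)) (2 * x ^ Suc m * ?S)"
    unfolding sum_distrib_left by (intro cong_D_sum) simp
  moreover have "cong_D p (2 * x ^ Suc m * ?S) (2 * x ^ Suc m * (- 4 * binom_odd m (16 * x)))"
    using assms by (intro cong_D_mult sum_central_binomial_odd_half cong_D_refl) auto
  ultimately have "cong_D p (sum ?f {..<Suc m} + (\<Sum>j<m. ?f (Suc m + j)))
      (binom_even m (16 * x) + 2 * x ^ Suc m * (- 4 * binom_odd m (16 * x)))"
    using assms by (intro cong_D_add sum_central_binomial_even_half) (assumption, rule cong_D_trans)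
  moreover have p_eq: "p = Suc m + m" using p by simp
  have "sum ?f {..<p} = sum ?f {..<Suc m} + (\<Sum>j<m. ?f (Suc m + j))"
    unfolding p_eq by (rule sum_lessThan_plus)
  ultimately show ?thesis by (simp only:) (simp add: algebra_simps)
qed

text \<open>Now the cut is at k = m, where 2k + 1 = p; beyond it k = m + j gives p + 2j, twice an
  even-index sum.\<close>

lemma sum_central_binomial_odd:
  assumes "x \<in> D p"
  shows "cong_D p (\<Sum>k<p. of_nat (central_binomial (2 * k + 1)) * x ^ k)
    (2 * x ^ m * binom_even m (16 * x) - 4 * binom_odd m (16 * x))"
proof -
  let ?f = "\<lambda>k. of_nat (central_binomial (2 * k + 1)) * x ^ k"
    and ?S = "\<Sum>j<Suc m. of_nat (central_binomial (2 * j)) * x ^ j"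
  have lt: "2 * j < p" if "j < Suc m" for j using that p by simp
  have "cong_D p (?f (m + j)) (2 * x ^ m * (of_nat (central_binomial (2 * j)) * x ^ j))"
    if "j < Suc m" for j
  proof -
    have "2 * (m + j) + 1 = p + 2 * j" using p by simp
    then have "cong_D p (?f (m + j)) (2 * of_nat (central_binomial (2 * j)) * x ^ (m + j))"
      using assms lt[OF that]
      by (simp only:) (intro cong_D_mult central_binomial_shift_cong_D cong_D_refl D_power)
    then show ?thesis by (simp only: power_add mult_ac)
  qed
  then have "cong_D p (\<Sum>j<Suc m. ?f (m + j)) (2 * x ^ m * ?S)"
    unfolding sum_distrib_left by (intro cong_D_sum) simp
  moreover have "cong_D p (2 * x ^ m * ?S) (2 * x ^ m * binom_even m (16 * x))"
    using assms by (intro cong_D_mult sum_central_binomial_even_half cong_D_refl) auto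
  ultimately have "cong_D p (sum ?f {..<m} + (\<Sum>j<Suc m. ?f (m + j)))
      (- 4 * binom_odd m (16 * x) + 2 * x ^ m * binom_even m (16 * x))"
    using assms by (intro cong_D_add sum_central_binomial_odd_half) (assumption, rule cong_D_trans)
  moreover have p_eq: "p = m + Suc m" using p by simp
  have "sum ?f {..<p} = sum ?f {..<m} + (\<Sum>j<Suc m. ?f (m + j))"
    unfolding p_eq by (rule sum_lessThan_plus)
  ultimately show ?thesis by (simp only:) (simp add: algebra_simps)
qed

section \<open>Fermat, Euler's criterion and Frobenius\<close>

lemma power_p: "x ^ p = x * x ^ m * x ^ m" for x :: rat
  by (simp add: p mult_2 power_add)

lemma cong_D_fermat_unit:
  assumes "x \<in> D p" "1 / x \<in> D p" "x \<noteq> 0"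
  shows "cong_D p (x ^ (2 * m)) 1"
proof -
  have "cong_D p (x ^ p * (1 / x)) (x * (1 / x))"
    using assms by (intro cong_D_mult cong_D_fermat cong_D_refl)
  then show ?thesis using assms(3) by (simp add: p)
qed

lemma m_pos: "m > 0"
  using prime_p p by (cases m) auto

lemma two_unit: "1 / 2 \<in> D p" "cong_D p (2 ^ (2 * m)) 1"
proof -
  show "1 / 2 \<in> D p" using D_half p by simp
  then show "cong_D p (2 ^ (2 * m)) 1" by (intro cong_D_fermat_unit) auto
qed

lemma Legendre_cong_D: "cong_D p (of_int (Legendre c (int p))) (of_int c ^ m)"
proof -
  have "[Legendre c (int p) = c ^ ((p - 1) div 2)] (mod int p)"
    using m_pos p prime_p by (intro euler_criterion) auto
  then show ?thesis using cong_D_of_int p by fastforce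
qed

text \<open>For c = a/b, (ab)^m = c^m b^(2m), and b^(p-1) is congruent to 1 because b is a
  unit.\<close>

lemma Legendre_rat_cong_D:
  assumes "c \<in> D p"
  shows "cong_D p (of_int (Legendre_rat c p)) (c ^ m)"
proof -
  obtain a b where ab: "quotient_of c = (a, b)" by force
  have b: "\<not> int p dvd b" using assms ab by (simp add: D_def)
  then have "b \<noteq> 0" by auto
  have c: "c = of_int a / of_int b" using quotient_of_div[OF ab] .
  have inv: "1 / of_int b \<in> D p" unfolding D_iff using b by (metis of_int_1)
  have "cong_D p (of_int (Legendre_rat c p)) (of_int (a * b) ^ m)"
    unfolding Legendre_rat_def ab fst_conv snd_conv by (rule Legendre_cong_D)
  also have "of_int (a * b) ^ m = c ^ m * of_int b ^ (2 * m)"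
    using \<open>b \<noteq> 0\<close> by (simp add: c power_mult_distrib power_divide mult_2 power_add)
  also have "cong_D p \<dots> (c ^ m * 1)"
    using \<open>b \<noteq> 0\<close> inv assms by (intro cong_D_mult cong_D_fermat_unit cong_D_refl) auto
  finally show ?thesis by simp
qed

text \<open>Frobenius: (1 + u)^p is congruent to 1 + u^p = 1 + u w^m when u^2 =
  \<open>w\<close>.\<close>

lemma binom_prime:
  assumes "w \<in> D p"
  shows "cong_D p (binom_even p w) 1" "cong_D p (binom_odd p w) (w ^ m)"
proof -
  have choose: "cong_D p (of_nat (p choose k)) (if k = 0 \<or> k = p then 1 else 0)" for k
  proof (cases "0 < k \<and> k < p")
    case True
    then have "[int (p choose k) = 0] (mod int p)"
      using dvd_choose_prime[of k p] prime_p by (auto simp: cong_0_iff)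
    from cong_D_of_int[OF this] show ?thesis using True by simp
  next
    case False
    then show ?thesis by (cases "k > p") (auto simp: binomial_eq_0)
  qed
  have "cong_D p (binom_even p w) (\<Sum>j\<le>p. (if 2 * j = 0 \<or> 2 * j = p then 1 else 0) * w ^ j)"
    unfolding binom_even_def using assms by (intro cong_D_sum cong_D_mult choose cong_D_refl) auto
  \<comment> \<open>As p is odd, 2j = p never happens.\<close>
  also have "(\<Sum>j\<le>p. (if 2 * j = 0 \<or> 2 * j = p then 1 else 0) * w ^ j) = (\<Sum>j\<le>p. if j = 0 then 1 else 0)"
    using p by (intro sum.cong) (auto, presburger)
  finally show "cong_D p (binom_even p w) 1" by simp
  have "cong_D p (binom_odd p w) (\<Sum>j\<le>p. (if 2 * j + 1 = 0 \<or> 2 * j + 1 = p then 1 else 0) * w ^ j)"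
    unfolding binom_odd_def using assms by (intro cong_D_sum cong_D_mult choose cong_D_refl) auto
  also have "(\<Sum>j\<le>p. (if 2 * j + 1 = 0 \<or> 2 * j + 1 = p then 1 else 0) * w ^ j) =
      (\<Sum>j\<le>p. if j = m then w ^ m else 0)"
    using p by (intro sum.cong) auto
  finally show "cong_D p (binom_odd p w) (w ^ m)" using p by simp
qed

text \<open>With \<alpha> = a^2, \<beta> = b^2 and u = 2ab, (1 + u)^(m+1) = (a + b)^(p+1) is
  congruent to (a^p + b^p)(a + b). Its even part is the first value; its odd part is ab (\<alpha>^m
  + \<beta>^m), that is u/2 times the second. The unit \<beta> allows w = (a/b)^2.\<close>

lemma binom_Suc_half:
  assumes "\<alpha> \<in> D p" "\<beta> \<in> D p" "1 / \<beta> \<in> D p" "\<beta> \<noteq> 0" "\<alpha> + \<beta> = 1"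
  shows "cong_D p (binom_even (Suc m) (4 * \<alpha> * \<beta>)) (\<alpha> ^ Suc m + \<beta> ^ Suc m)"
    and "cong_D p (2 * binom_odd (Suc m) (4 * \<alpha> * \<beta>)) (\<alpha> ^ m + \<beta> ^ m)"
proof -
  define w where "w = \<alpha> / \<beta>"
  have w: "w \<in> D p" using D_mult[OF assms(1,3)] by (simp add: w_def)
  note double = binom_even_odd_double[OF assms(5,4), of "Suc m", folded w_def]
  have M: "2 * Suc m = Suc p" by (simp add: p)
  have "binom_even (Suc m) (4 * \<alpha> * \<beta>) = \<beta> ^ Suc m * (binom_even p w + w * binom_odd p w)"
    using double unfolding M by (simp only: binom_even_Suc)
  also have "cong_D p \<dots> (\<beta> ^ Suc m * (1 + w * w ^ m))"
    using assms w by (intro cong_D_mult cong_D_add binom_prime cong_D_refl) auto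
  also have "\<beta> ^ Suc m * (1 + w * w ^ m) = \<alpha> ^ Suc m + \<beta> ^ Suc m"
    using assms(4) by (simp add: w_def power_divide field_simps)
  finally show "cong_D p (binom_even (Suc m) (4 * \<alpha> * \<beta>)) (\<alpha> ^ Suc m + \<beta> ^ Suc m)" .
  have "2 * binom_odd (Suc m) (4 * \<alpha> * \<beta>) = (1 / \<beta>) * (2 * \<beta> * binom_odd (Suc m) (4 * \<alpha> * \<beta>))"
    using assms(4) by simp
  also have "\<dots> = (1 / \<beta>) * (\<beta> ^ Suc m * (binom_even p w + binom_odd p w))"
    using double unfolding M by (simp only: binom_odd_Suc)
  also have "cong_D p \<dots> ((1 / \<beta>) * (\<beta> ^ Suc m * (1 + w ^ m)))"
    using assms w by (intro cong_D_mult cong_D_add binom_prime cong_D_refl) auto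
  also have "(1 / \<beta>) * (\<beta> ^ Suc m * (1 + w ^ m)) = \<alpha> ^ m + \<beta> ^ m"
    using assms(4) by (simp add: w_def power_divide field_simps)
  finally show "cong_D p (2 * binom_odd (Suc m) (4 * \<alpha> * \<beta>)) (\<alpha> ^ m + \<beta> ^ m)" .
qed

section \<open>Closed forms of the two sums\<close>

text \<open>Writing U, V for the parts at exponent m, the Catalan formula yields 2(U + V) - x^m (U +
  16xV), and the brackets are the parts at exponent m + 1.\<close>

lemma sum_catalan:
  assumes "x \<in> D p"
  shows "cong_D p (\<Sum>k<p. catalan (2 * k) * x ^ k)
    (2 * binom_odd (Suc m) (16 * x) - x ^ m * binom_even (Suc m) (16 * x))"
proof -
  let ?E = "\<Sum>k<p. of_nat (central_binomial (2 * k)) * x ^ k"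
    and ?G = "\<Sum>k<p. of_nat (central_binomial (2 * k + 1)) * x ^ k"
    and ?U = "binom_even m (16 * x)" and ?V = "binom_odd m (16 * x)"
  have "(\<Sum>k<p. catalan (2 * k) * x ^ k) = 2 * ?E - (1 / 2) * ?G"
    unfolding catalan_central_binomial sum_distrib_left sum_subtractf[symmetric]
    by (intro sum.cong) (simp_all add: algebra_simps del: binomial_Suc_Suc mult_Suc_right)
  also have "cong_D p \<dots> (2 * (?U - 8 * x ^ Suc m * ?V) - (1 / 2) * (2 * x ^ m * ?U - 4 * ?V))"
    using assms two_unit
    by (intro cong_D_diff cong_D_mult cong_D_refl sum_central_binomial_even sum_central_binomial_odd) auto
  also have "2 * (?U - 8 * x ^ Suc m * ?V) - (1 / 2) * (2 * x ^ m * ?U - 4 * ?V) =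
      2 * binom_odd (Suc m) (16 * x) - x ^ m * binom_even (Suc m) (16 * x)"
    by (simp add: binom_even_Suc binom_odd_Suc algebra_simps)
  finally show ?thesis .
qed

lemma sum_catalan_product:
  assumes "\<alpha> \<in> D p" "\<beta> \<in> D p" "\<alpha> + \<beta> = 1"
  shows "cong_D p (\<Sum>k<p. catalan (2 * k) * (\<alpha> * \<beta> / 4) ^ k) (\<alpha> ^ Suc m + \<beta> ^ Suc m)"
  using assms(2)
proof (cases rule: D_inverse_cases)
  \<comment> \<open>Division by \<beta> is impossible here, but then \<alpha> is congruent to 1 and
    the sum collapses to its constant term, since 0^0 = 1.\<close>
  case 1
  have "\<alpha> = 1 - \<beta>" using assms(3) by simp
  then have \<alpha>1: "cong_D p \<alpha> (1 - 0)" using 1 by (simp only:) (intro cong_D_diff cong_D_refl, auto)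
  have "cong_D p (\<alpha> * (1 / 2 * (1 / 2)) * \<beta>) (\<alpha> * (1 / 2 * (1 / 2)) * 0)"
    using 1 assms two_unit by (intro cong_D_mult cong_D_refl) auto
  then have x: "cong_D p (\<alpha> * \<beta> / 4) 0" by simp
  have "catalan n \<in> D p" for n
    using D_diff[OF D_mult[OF D_numeral(1) D_of_nat] D_mult[OF two_unit(1) D_of_nat]]
    unfolding catalan_central_binomial by (simp del: binomial_Suc_Suc mult_Suc_right)
  then have "cong_D p (\<Sum>k<p. catalan (2 * k) * (\<alpha> * \<beta> / 4) ^ k) (\<Sum>k<p. catalan (2 * k) * 0 ^ k)"
    by (intro cong_D_sum cong_D_mult cong_D_power x cong_D_refl)
  also have "(\<Sum>k<p. catalan (2 * k) * 0 ^ k) = (\<Sum>k<p. if k = 0 then 1 else 0)"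
    by (intro sum.cong) (auto simp: catalan_def)
  \<comment> \<open>The value 1 is spelled out so that \<alpha> and \<beta> can replace their
    residues 1 - 0 and 0.\<close>
  also have "\<dots> = (1 - 0) ^ Suc m + 0 ^ Suc m" using p by simp
  also have "cong_D p \<dots> (\<alpha> ^ Suc m + \<beta> ^ Suc m)"
    by (intro cong_D_add cong_D_power cong_D_sym[OF \<alpha>1] cong_D_sym[OF 1])
  finally show ?thesis .
next
  case 2
  define x where "x = \<alpha> * \<beta> / 4"
  have "\<alpha> * \<beta> * (1 / 2 * (1 / 2)) \<in> D p"
    using assms two_unit by (intro D_mult)
  then have x: "x \<in> D p" by (simp add: x_def)
  have x16: "16 * x = 4 * \<alpha> * \<beta>" by (simp add: x_def)
  \<comment> \<open>The denominator 4^m of x^m is 2^(p-1), hence congruent to 1.\<close>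
  have "cong_D p (x ^ m * 1) (x ^ m * 2 ^ (2 * m))"
    by (intro cong_D_mult cong_D_refl cong_D_sym[OF two_unit(2)] D_power x)
  also have "x ^ m * 2 ^ (2 * m) = (\<alpha> * \<beta>) ^ m"
    by (simp add: x_def power_divide power_mult)
  finally have xm: "cong_D p (x ^ m) ((\<alpha> * \<beta>) ^ m)" by simp
  have "cong_D p (\<Sum>k<p. catalan (2 * k) * x ^ k)
      (2 * binom_odd (Suc m) (4 * \<alpha> * \<beta>) - x ^ m * binom_even (Suc m) (4 * \<alpha> * \<beta>))"
    using sum_catalan[OF x] unfolding x16 .
  also have "cong_D p \<dots> ((\<alpha> ^ m + \<beta> ^ m) - (\<alpha> * \<beta>) ^ m * (\<alpha> ^ Suc m + \<beta> ^ Suc m))"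
    using assms 2 by (intro cong_D_diff cong_D_mult xm binom_Suc_half)
  \<comment> \<open>Collecting exponents 2m + 1 = p prepares for Fermat; afterwards \<alpha> +
    \<beta> = 1 merges the two differences into the claimed sum.\<close>
  also have "(\<alpha> ^ m + \<beta> ^ m) - (\<alpha> * \<beta>) ^ m * (\<alpha> ^ Suc m + \<beta> ^ Suc m) =
      (\<alpha> ^ m + \<beta> ^ m) - (\<beta> ^ m * \<alpha> ^ p + \<alpha> ^ m * \<beta> ^ p)"
    by (simp add: power_p power_mult_distrib algebra_simps)
  also have "cong_D p \<dots> ((\<alpha> ^ m + \<beta> ^ m) - (\<beta> ^ m * \<alpha> + \<alpha> ^ m * \<beta>))"
    using assms by (intro cong_D_diff cong_D_add cong_D_mult cong_D_fermat cong_D_refl) auto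
  also have "(\<alpha> ^ m + \<beta> ^ m) - (\<beta> ^ m * \<alpha> + \<alpha> ^ m * \<beta>) = \<alpha> ^ m * (1 - \<beta>) + \<beta> ^ m * (1 - \<alpha>)"
    by (simp add: algebra_simps)
  also have "1 - \<beta> = \<alpha>" using assms(3) by simp
  also have "1 - \<alpha> = \<beta>" using assms(3) by simp
  finally show ?thesis by (simp add: x_def mult.commute)
qed

lemma catalan_sum_Legendre:
  assumes t: "t \<in> D p"
  shows "cong_D p (\<Sum>k<p. catalan (2 * k) * ((1 - t\<^sup>2) / 16) ^ k)
    (1 / 2 * of_int (Legendre 2 (int p)) *
      (of_int (Legendre_rat (1 - t) p) * (1 - t) + of_int (Legendre_rat (1 + t) p) * (1 + t)))"
proof -
  define \<alpha> \<beta> where "\<alpha> = (1 + t) * (1 / 2)" and "\<beta> = (1 - t) * (1 / 2)"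
  have D: "\<alpha> \<in> D p" "\<beta> \<in> D p" and one: "\<alpha> + \<beta> = 1"
    using D_mult[OF _ two_unit(1)] t by (auto simp: \<alpha>_def \<beta>_def simp flip: add_divide_distrib)
  have "(1 - t\<^sup>2) / 16 = \<alpha> * \<beta> / 4"
    by (simp add: \<alpha>_def \<beta>_def power2_eq_square algebra_simps)
  then have "cong_D p (\<Sum>k<p. catalan (2 * k) * ((1 - t\<^sup>2) / 16) ^ k) (1 * (\<alpha> ^ Suc m + \<beta> ^ Suc m))"
    using sum_catalan_product[OF D one] by (simp only: mult_1)
  \<comment> \<open>Multiplying by 2^(p-1) clears the halves in \<alpha> and \<beta>: of 2^(2m), the
    factor 2^(m+1) is absorbed and 2^m / 2 remains, which becomes half the Legendre symbol of
    2.\<close>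
  also have "cong_D p \<dots> (2 ^ (2 * m) * (\<alpha> ^ Suc m + \<beta> ^ Suc m))"
    using D by (intro cong_D_mult cong_D_refl cong_D_sym[OF two_unit(2)]) auto
  also have "2 ^ (2 * m) * (\<alpha> ^ Suc m + \<beta> ^ Suc m) =
      1 / 2 * of_int 2 ^ m * ((1 - t) ^ m * (1 - t) + (1 + t) ^ m * (1 + t))"
  proof -
    have "2 ^ (2 * m) * y ^ Suc m = 1 / 2 * 2 ^ m * ((2 * y) ^ m * (2 * y))" for y :: rat
      by (simp add: power_mult_distrib mult_2[of m] power_add)
    moreover have "2 * \<alpha> = 1 + t" "2 * \<beta> = 1 - t" by (simp_all add: \<alpha>_def \<beta>_def)
    ultimately show ?thesis by (simp only: distrib_left of_int_numeral add.commute)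
  qed
  also have "cong_D p \<dots> (1 / 2 * of_int (Legendre 2 (int p)) *
      (of_int (Legendre_rat (1 - t) p) * (1 - t) + of_int (Legendre_rat (1 + t) p) * (1 + t)))"
    using t two_unit by (intro cong_D_mult cong_D_add cong_D_sym[OF Legendre_cong_D]
        cong_D_sym[OF Legendre_rat_cong_D] cong_D_refl) auto
  finally show ?thesis .
qed

lemma central_binomial_sum_Legendre:
  assumes t: "t \<in> D p"
  shows "cong_D p (\<Sum>k<p. of_nat ((4 * k) choose (2 * k)) * t ^ (2 * k))
    (1 / 2 * (of_int (Legendre_rat (1 - 4 * t) p) * (1 + 2 * t)
      + of_int (Legendre_rat (1 + 4 * t) p) * (1 - 2 * t)))"
proof -
  let ?U = "binom_even m (16 * t\<^sup>2)" and ?V = "binom_odd m (16 * t\<^sup>2)"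
  have pow: "(1 + 4 * t) ^ m = ?U + 4 * t * ?V" "(1 - 4 * t) ^ m = ?U - 4 * t * ?V"
    using one_plus_power_binom[of "4 * t" m] one_plus_power_binom[of "- (4 * t)" m]
    by (simp_all add: power_mult_distrib)
  have "(\<Sum>k<p. of_nat ((4 * k) choose (2 * k)) * t ^ (2 * k)) =
      (\<Sum>k<p. of_nat (central_binomial (2 * k)) * (t\<^sup>2) ^ k)"
    by (simp add: power_mult)
  also have "cong_D p \<dots> (?U - 8 * (t\<^sup>2) ^ Suc m * ?V)"
    using t by (intro sum_central_binomial_even) simp
  \<comment> \<open>The exponent 2m + 2 equals p + 1, so Fermat reduces this power to t^2.\<close>
  also have "(t\<^sup>2) ^ Suc m = t ^ p * t"
    by (simp add: power_p power2_eq_square power_mult_distrib)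
  also have "cong_D p (?U - 8 * (t ^ p * t) * ?V) (?U - 8 * (t * t) * ?V)"
    using t by (intro cong_D_diff cong_D_mult cong_D_fermat cong_D_refl) auto
  \<comment> \<open>By \<open>pow\<close>, U and 4tV are half the sum and half the difference of (1
    + 4t)^m and (1 - 4t)^m, and 8t^2 V = 2t * 4tV.\<close>
  also have "?U - 8 * (t * t) * ?V = 1 / 2 * ((1 - 4 * t) ^ m * (1 + 2 * t) + (1 + 4 * t) ^ m * (1 - 2 * t))"
    unfolding pow by (simp add: algebra_simps)
  also have "cong_D p \<dots> (1 / 2 * (of_int (Legendre_rat (1 - 4 * t) p) * (1 + 2 * t)
      + of_int (Legendre_rat (1 + 4 * t) p) * (1 - 2 * t)))"
    using t two_unit by (intro cong_D_mult cong_D_add cong_D_sym[OF Legendre_rat_cong_D] cong_D_refl) auto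
  finally show ?thesis .
qed

end

end

theorem theorem9:
  fixes p :: nat and t :: rat
  assumes "prime p" and "p > 3" and "t \<in> D p"
  shows "cong_D p
           (\<Sum>k = 0..p - 1. catalan (2 * k) * ((1 - t\<^sup>2) / 16) ^ k)
           (1 / 2 * of_int (Legendre 2 (int p)) *
             (of_int (Legendre_rat (1 - t) p) * (1 - t) + of_int (Legendre_rat (1 + t) p) * (1 + t)))
       \<and> cong_D p
           (\<Sum>k = 0..p - 1. of_nat ((4 * k) choose (2 * k)) * t ^ (2 * k))
           (1 / 2 *
             (of_int (Legendre_rat (1 - 4 * t) p) * (1 + 2 * t)
               + of_int (Legendre_rat (1 + 4 * t) p) * (1 - 2 * t)))"
proof -
  have "odd p" using assms prime_odd_nat by auto
  then obtain m where p: "p = 2 * m + 1" by (elim oddE)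
  have "{0..p - 1} = {..<p}" using p by auto
  then show ?thesis
    using catalan_sum_Legendre[OF assms(1) p assms(3)]
      central_binomial_sum_Legendre[OF assms(1) p assms(3)] by simp
qed

end
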